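(* Define polynomials $P_w, Q_w\in\mathbb{Z}[z]$ by $P_0=1,\ Q_0=1$; $P_1=1,\ Q_1=1-z$; $P_2=1-z,\ Q_2=1-2z-3z^2$; $P_3=1-2z-3z^2,\ Q_3=1-3z-5z^2-2z^3+z^4$; $P_4=1-3z-5z^2-2z^3+z^4,\ Q_4=1-4z-6z^2+2z^3$; and for $w\ge 5$, $$P_w=Q_{w-1},\qquad Q_w=(1+z)Q_{w-1}-2zQ_{w-2}-2z^2Q_{w-3}+(z^3+z^4)Q_{w-4}-z^5Q_{w-5}.$$ For an integer $w\ge0$ let $F_w(z)=\sum_{n\ge0}a_{w,n}z^n$, where $a_{w,n}$ is the number of lattice walks with steps $(1,1)$, $(1,-1)$, $(2,2)$, $(2,-2)$ from $(0,0)$ to $(2n,0)$ that never leave the strip $0\le y\le w$ (with $a_{w,0}=1$ for the empty walk). Then for every $w\ge 0$, $F_w = P_w/Q_w$ (as formal power series in $z$).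
   Context: In the paper the denominator polynomials $Q_w$ are denoted by a special symbol ("AZ$_w$"); here they are written $Q_w$. *)

theory Defs
  imports
    Complex_Main
    "HOL-Library.Product_Plus"
    "HOL-Computational_Algebra.Polynomial_FPS"
begin

text \<open>Coefficient lists of polynomials are written in order of increasing degree.\<close>

fun Q :: "nat \<Rightarrow> int poly" where
  "Q 0 = 1"
| "Q (Suc 0) = [:1, -1:]"
| "Q (Suc (Suc 0)) = [:1, -2, -3:]"
| "Q (Suc (Suc (Suc 0))) = [:1, -3, -5, -2, 1:]"
| "Q (Suc (Suc (Suc (Suc 0)))) = [:1, -4, -6, 2:]"
| "Q (Suc (Suc (Suc (Suc (Suc w))))) =
     [:1, 1:] * Q (Suc (Suc (Suc (Suc w))))
     - [:0, 2:] * Q (Suc (Suc (Suc w)))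
     - [:0, 0, 2:] * Q (Suc (Suc w))
     + [:0, 0, 0, 1, 1:] * Q (Suc w)
     - [:0, 0, 0, 0, 0, 1:] * Q w"

fun P :: "nat \<Rightarrow> int poly" where
  "P 0 = 1"
| "P (Suc 0) = 1"
| "P (Suc (Suc 0)) = [:1, -1:]"
| "P (Suc (Suc (Suc 0))) = [:1, -2, -3:]"
| "P (Suc (Suc (Suc (Suc 0)))) = [:1, -3, -5, -2, 1:]"
| "P (Suc (Suc (Suc (Suc (Suc w))))) = Q (Suc (Suc (Suc (Suc w))))"

definition steps :: "(int \<times> int) set" where
  "steps = {(1, 1), (1, -1), (2, 2), (2, -2)}"

text \<open>
  A walk starting at the origin is the list of its steps; the point reached after its
  first k steps is the componentwise sum of these steps. As the strip is convex, the
  walk stays in it as soon as these points do.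
\<close>

definition strip_walks :: "nat \<Rightarrow> nat \<Rightarrow> (int \<times> int) list set" where
  "strip_walks w n =
     {ss. set ss \<subseteq> steps \<and> sum_list ss = (2 * int n, 0) \<and>
          (\<forall>k\<le>length ss. 0 \<le> snd (sum_list (take k ss)) \<and> snd (sum_list (take k ss)) \<le> int w)}"

text \<open>The cardinality of an infinite set is 0 by convention; this is not an issue here.\<close>

lemma finite_strip_walks: "finite (strip_walks w n)"
proof -
  have len: "int (length ss) \<le> fst (sum_list ss)" if "set ss \<subseteq> steps" for ss
    using that by (induction ss) (auto simp: steps_def)
  have "strip_walks w n \<subseteq> {ss. set ss \<subseteq> steps \<and> length ss \<le> 2 * n}"
    using len by (force simp: strip_walks_def)
  moreover have "finite {ss. set ss \<subseteq> steps \<and> length ss \<le> 2 * n}"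
    by (rule finite_lists_length_le) (simp add: steps_def)
  ultimately show ?thesis
    by (rule finite_subset)
qed

definition a :: "nat \<Rightarrow> nat \<Rightarrow> nat" where
  "a w n = card (strip_walks w n)"

text \<open>
  The series are taken over the rationals, where the quotient of power series is the
  usual one whenever the denominator has nonzero constant coefficient.
\<close>

definition F :: "nat \<Rightarrow> rat fps" where
  "F w = Abs_fps (\<lambda>n. of_nat (a w n))"

lemma coeff_Q_0: "coeff (Q w) 0 = 1"
  by (induction w rule: Q.induct) (simp_all add: coeff_mult)

end

theory Submission
  imports Defs
begin

text \<open>
  Let \<open>h i\<close> be the generating function of the walks from height \<open>i\<close> to height 0, so that \<open>F w = h 0\<close>.
  Splitting off the first step gives a linear system for \<open>h 0, \<dots>, h w\<close> with right-hand side
  \<open>(1, 0, \<dots>, 0)\<close>. Removing the row of height 0 leaves the system of the strip of width \<open>w - 1\<close> with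
  a right-hand side supported on its first two entries, because steps change the height by at most
  2. Hence by induction on \<open>w\<close> the first two unknowns of such a system are given by Cramer's rule
  with denominator \<open>Q w\<close>, and the numerator of \<open>h 0\<close> is \<open>P w\<close>.
\<close>

unbundle fps_syntax

section \<open>Walks with a variable starting height\<close>

text \<open>Integer parameters let all four summands of the first-step recursion appear
  unconditionally: heights outside the strip and distances that are too short give the empty
  set.\<close>

definition walks_from :: "nat \<Rightarrow> int \<Rightarrow> int \<Rightarrow> (int \<times> int) list set" where
  "walks_from w i m =
     {ss. set ss \<subseteq> steps \<and> sum_list ss = (m, - i) \<and>
          (\<forall>k\<le>length ss. 0 \<le> i + snd (sum_list (take k ss)) \<and> i + snd (sum_list (take k ss)) \<le> int w)}"

lemma strip_walks_eq: "strip_walks w n = walks_from w 0 (2 * int n)"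
  by (simp add: strip_walks_def walks_from_def)

lemma length_le_fst_sum:
  assumes "set ss \<subseteq> steps"
  shows "int (length ss) \<le> fst (sum_list ss)"
  using assms by (induction ss) (auto simp: steps_def)

lemma abs_snd_le_fst_sum:
  assumes "set ss \<subseteq> steps"
  shows "\<bar>snd (sum_list ss)\<bar> \<le> fst (sum_list ss)"
  using assms by (induction ss) (auto simp: steps_def)

lemma finite_walks_from: "finite (walks_from w i m)"
proof -
  have "walks_from w i m \<subseteq> {ss. set ss \<subseteq> steps \<and> length ss \<le> nat m}"
    using length_le_fst_sum by (force simp: walks_from_def)
  moreover have "finite {ss. set ss \<subseteq> steps \<and> length ss \<le> nat m}"
    by (rule finite_lists_length_le) (simp add: steps_def)
  ultimately show ?thesis
    by (rule finite_subset)
qed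

lemma walks_from_outside: "i < 0 \<or> i > int w \<Longrightarrow> walks_from w i m = {}"
  by (auto simp: walks_from_def)

lemma walks_from_short: "m < i \<Longrightarrow> walks_from w i m = {}"
  using abs_snd_le_fst_sum by (force simp: walks_from_def)

lemma Nil_in_walks_from: "[] \<in> walks_from w i m \<longleftrightarrow> m = 0 \<and> i = 0"
  by (auto simp: walks_from_def zero_prod_def)

lemma Cons_in_walks_from:
  assumes "0 \<le> i" "i \<le> int w"
  shows "s # ss \<in> walks_from w i m \<longleftrightarrow> s \<in> steps \<and> ss \<in> walks_from w (i + snd s) (m - fst s)"
proof -
  have all_le_Suc: "(\<forall>k\<le>Suc l. R k) \<longleftrightarrow> R 0 \<and> (\<forall>k\<le>l. R (Suc k))" for R l
    by (metis le0 not0_implies_Suc not_less_eq_eq)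
  have "s + sum_list ss = (m, - i) \<longleftrightarrow> sum_list ss = (m - fst s, - (i + snd s))"
    by (auto simp: prod_eq_iff)
  then show ?thesis
    using assms by (auto simp: walks_from_def all_le_Suc add.assoc)
qed

lemma card_walks_from:
  assumes "0 \<le> i" "i \<le> int w"
  shows "card (walks_from w i m) =
    (if m = 0 \<and> i = 0 then 1 else 0)
    + card (walks_from w (i - 1) (m - 1)) + card (walks_from w (i - 2) (m - 2))
    + card (walks_from w (i + 1) (m - 1)) + card (walks_from w (i + 2) (m - 2))"
proof -
  define N :: "(int \<times> int) list set" where "N = (if m = 0 \<and> i = 0 then {[]} else {})"
  define C where "C s = Cons s ` walks_from w (i + snd s) (m - fst s)" for s
  have "walks_from w i m = N \<union> (\<Union>s\<in>steps. C s)"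
  proof (rule set_eqI)
    fix ss
    show "ss \<in> walks_from w i m \<longleftrightarrow> ss \<in> N \<union> (\<Union>s\<in>steps. C s)"
      by (cases ss)
        (auto simp: N_def C_def Nil_in_walks_from Cons_in_walks_from[OF assms])
  qed
  moreover have "card (N \<union> (\<Union>s\<in>steps. C s)) = card N + card (\<Union>s\<in>steps. C s)"
    by (rule card_Un_disjoint) (auto simp: N_def C_def steps_def finite_walks_from)
  moreover have "card (\<Union>s\<in>steps. C s) = (\<Sum>s\<in>steps. card (C s))"
    by (rule card_UN_disjoint) (auto simp: C_def steps_def finite_walks_from)
  moreover have "card (C s) = card (walks_from w (i + snd s) (m - fst s))" for s
    unfolding C_def by (rule card_image) simp
  moreover have "card N = (if m = 0 \<and> i = 0 then 1 else 0)"
    by (simp add: N_def)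
  ultimately show ?thesis
    by (simp add: steps_def)
qed

section \<open>Generating functions by starting height\<close>

text \<open>
  A walk from height \<open>i\<close> to height 0 has length \<open>i + 2 * n\<close> for some \<open>n \<ge> 0\<close>. Recording \<open>n\<close>
  instead of the length keeps the series in \<open>z\<close>: up-steps get the weights \<open>z\<close> and \<open>z\<^sup>2\<close>,
  and down-steps the weight 1.
\<close>

definition height_gf :: "nat \<Rightarrow> nat \<Rightarrow> rat fps" where
  "height_gf w i = Abs_fps (\<lambda>n. of_nat (card (walks_from w (int i) (2 * int n + int i))))"

lemma height_gf_outside: "i > w \<Longrightarrow> height_gf w i = 0"
  by (rule fps_ext) (simp add: height_gf_def walks_from_outside)

lemma nth_X_height_gf:
  "(fps_X * height_gf w i) $ n = of_nat (card (walks_from w (int i) (2 * int n + int i - 2)))"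
proof (cases n)
  case 0
  \<comment> \<open>At \<open>n = 0\<close> the distance \<open>int i - 2\<close> is below the
    height, so the count is 0 as well.\<close>
  then show ?thesis by (simp add: walks_from_short)
next
  case (Suc k)
  then show ?thesis by (simp add: height_gf_def algebra_simps)
qed

lemma nth_X2_height_gf:
  "(fps_X^2 * height_gf w i) $ n = of_nat (card (walks_from w (int i) (2 * int n + int i - 4)))"
proof (cases n)
  case 0
  then show ?thesis by (simp add: walks_from_short power2_eq_square mult.assoc)
next
  case (Suc k)
  then show ?thesis
    using nth_X_height_gf[of w i k] by (simp add: algebra_simps power2_eq_square)
qed

lemma height_gf_step:
  assumes "i \<le> w"
  shows "height_gf w i = (if i = 0 then 1 else 0) + (if 1 \<le> i then height_gf w (i - 1) else 0)
    + (if 2 \<le> i then height_gf w (i - 2) else 0)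
    + fps_X * height_gf w (i + 1) + fps_X^2 * height_gf w (i + 2)"
proof (rule fps_ext)
  fix n
  have down1: "(if 1 \<le> i then height_gf w (i - 1) else 0) $ n
      = of_nat (card (walks_from w (int i - 1) (2 * int n + int i - 1)))"
    by (auto simp: height_gf_def walks_from_outside of_nat_diff algebra_simps)
  have down2: "(if 2 \<le> i then height_gf w (i - 2) else 0) $ n
      = of_nat (card (walks_from w (int i - 2) (2 * int n + int i - 2)))"
    by (auto simp: height_gf_def walks_from_outside of_nat_diff algebra_simps)
  have up1: "(fps_X * height_gf w (i + 1)) $ n
      = of_nat (card (walks_from w (int i + 1) (2 * int n + int i - 1)))"
    unfolding nth_X_height_gf by (simp add: algebra_simps)
  have up2: "(fps_X^2 * height_gf w (i + 2)) $ n
      = of_nat (card (walks_from w (int i + 2) (2 * int n + int i - 2)))"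
    unfolding nth_X2_height_gf by (simp add: algebra_simps)
  have "height_gf w i $ n = of_nat (card (walks_from w (int i) (2 * int n + int i)))"
    by (simp add: height_gf_def)
  also have "\<dots> = (if i = 0 then 1 else 0 :: rat fps) $ n
      + of_nat (card (walks_from w (int i - 1) (2 * int n + int i - 1)))
      + of_nat (card (walks_from w (int i - 2) (2 * int n + int i - 2)))
      + of_nat (card (walks_from w (int i + 1) (2 * int n + int i - 1)))
      + of_nat (card (walks_from w (int i + 2) (2 * int n + int i - 2)))"
    using assms by (subst card_walks_from) auto
  finally show "height_gf w i $ n = ((if i = 0 then 1 else 0) + (if 1 \<le> i then height_gf w (i - 1) else 0)
    + (if 2 \<le> i then height_gf w (i - 2) else 0)
    + fps_X * height_gf w (i + 1) + fps_X^2 * height_gf w (i + 2)) $ n"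
    by (simp only: fps_add_nth down1 down2 up1 up2)
qed

section \<open>Cramer's rule for strip systems\<close>

text \<open>
  \<open>h\<close> solves \<open>(I - T) h = (p, q, 0, \<dots>, 0)\<close>, where \<open>T\<close> is the weighted step matrix of the strip; for
  \<open>w = 0\<close> the value of \<open>q\<close> is irrelevant.
\<close>

definition strip_solution ::
  "'a::comm_ring_1 \<Rightarrow> nat \<Rightarrow> 'a \<Rightarrow> 'a \<Rightarrow> (nat \<Rightarrow> 'a) \<Rightarrow> bool" where
  "strip_solution z w p q h \<longleftrightarrow>
     (\<forall>i>w. h i = 0) \<and>
     h 0 = p + z * h 1 + z^2 * h 2 \<and>
     (1 \<le> w \<longrightarrow> h 1 = q + h 0 + z * h 2 + z^2 * h 3) \<and>
     (\<forall>i. i + 2 \<le> w \<longrightarrow> h (i + 2) = h (i + 1) + h i + z * h (i + 3) + z^2 * h (i + 4))"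

lemma strip_solutionD:
  assumes "strip_solution z w p q h"
  shows "i > w \<Longrightarrow> h i = 0"
    and "h 0 = p + z * h 1 + z^2 * h 2"
    and "1 \<le> w \<Longrightarrow> h 1 = q + h 0 + z * h 2 + z^2 * h 3"
    and "i + 2 \<le> w \<Longrightarrow> h (i + 2) = h (i + 1) + h i + z * h (i + 3) + z^2 * h (i + 4)"
  using assms unfolding strip_solution_def by blast+

lemma strip_solution_height_gf: "strip_solution fps_X w 1 0 (height_gf w)"
  unfolding strip_solution_def
proof (intro conjI allI impI)
  show "height_gf w 0 = 1 + fps_X * height_gf w 1 + fps_X^2 * height_gf w 2"
    using height_gf_step[of 0 w] by (simp add: numeral_2_eq_2)
next
  assume "1 \<le> w"
  then show "height_gf w 1 = 0 + height_gf w 0 + fps_X * height_gf w 2 + fps_X^2 * height_gf w 3"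
    using height_gf_step[of 1 w] by (simp add: numeral_eq_Suc)
next
  fix i assume "i + 2 \<le> w"
  then show "height_gf w (i + 2) = height_gf w (i + 1) + height_gf w i
      + fps_X * height_gf w (i + 3) + fps_X^2 * height_gf w (i + 4)"
    using height_gf_step[of "i + 2" w] by (simp add: numeral_eq_Suc)
qed (rule height_gf_outside)

text \<open>With \<open>h 0\<close> regarded as known, its terms in rows 1 and 2 move to the
  right-hand side.\<close>

lemma strip_solution_Suc:
  assumes "strip_solution z (Suc w) p q h"
  shows "strip_solution z w (q + h 0) (h 0) (\<lambda>i. h (Suc i))"
  unfolding strip_solution_def
proof (intro conjI allI impI)
  fix i assume "i + 2 \<le> w"
  then show "h (Suc (i + 2)) = h (Suc (i + 1)) + h (Suc i) + z * h (Suc (i + 3)) + z^2 * h (Suc (i + 4))"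
    using strip_solutionD(4)[OF assms, of "Suc i"] by simp
next
  assume "1 \<le> w"
  then show "h (Suc 1) = h 0 + h (Suc 0) + z * h (Suc 2) + z^2 * h (Suc 3)"
    using strip_solutionD(4)[OF assms, of 0] by (simp add: numeral_eq_Suc)
next
  show "h (Suc 0) = q + h 0 + z * h (Suc 1) + z^2 * h (Suc 2)"
    using strip_solutionD(3)[OF assms] by (simp add: numeral_eq_Suc)
qed (simp add: strip_solutionD(1)[OF assms])

text \<open>Cramer's rule without division. \<open>p\<close> and \<open>q\<close> stay arbitrary
  because passing to the smaller strip changes them.\<close>

lemma strip_solution_values:
  fixes z :: "'a::idom" and D E n m :: "nat \<Rightarrow> 'a"
  assumes D0: "D 0 = 1" and E0: "E 0 = 1" and n0: "n 0 = 0" and m0: "m 0 = 0"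
    and E: "\<And>w. E (Suc w) = D w"
    and n: "\<And>w. n (Suc w) = E w + z * n w"
    and D: "\<And>w. D (Suc w) = D w - z * E w - 2 * z^2 * n w - z^2 * m w"
    and m: "\<And>w. m (Suc w) * D w = E w * D (Suc w) + z * (n (Suc w))^2"
    and nz: "\<And>w. D w \<noteq> 0"
    and h: "strip_solution z w p q h"
  shows "D w * h 0 = E w * p + z * n w * q \<and> D w * h 1 = n w * p + m w * q"
  using h
proof (induction w arbitrary: p q h)
  case 0
  then show ?case
    by (simp add: strip_solution_def D0 E0 n0 m0)
next
  case (Suc w)
  have h0: "h 0 = p + z * h 1 + z^2 * h 2"
    by (rule strip_solutionD(2)[OF Suc.prems])
  from Suc.IH[OF strip_solution_Suc[OF Suc.prems]]
  have h1: "D w * h 1 = E w * (q + h 0) + z * n w * h 0"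
    and h2: "D w * h 2 = n w * (q + h 0) + m w * h 0"
    by (simp_all add: numeral_eq_Suc)
  have "D w * h 0 = D w * p + z * (D w * h 1) + z^2 * (D w * h 2)"
    by (subst h0) (simp add: algebra_simps)
  then have first: "D (Suc w) * h 0 = E (Suc w) * p + z * n (Suc w) * q"
    unfolding h1 h2 D E n by (simp add: algebra_simps power2_eq_square)
  \<comment> \<open>The extra factor \<open>D w\<close> allows the value from the smaller strip to
    be inserted; by \<open>m\<close> it becomes a common factor and cancels.\<close>
  have "D w * (D (Suc w) * h 1) = D (Suc w) * (D w * h 1)"
    by (simp only: ac_simps)
  also have "\<dots> = D (Suc w) * (E w * q) + n (Suc w) * (D (Suc w) * h 0)"
    unfolding h1 by (simp add: n algebra_simps)
  also have "\<dots> = D w * (n (Suc w) * p) + (E w * D (Suc w) + z * (n (Suc w))^2) * q"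
    unfolding first E by (simp add: algebra_simps power2_eq_square)
  also have "\<dots> = D w * (n (Suc w) * p + m (Suc w) * q)"
    by (simp add: m[symmetric] algebra_simps)
  finally have "D (Suc w) * h 1 = n (Suc w) * p + m (Suc w) * q"
    using nz by simp
  with first show ?case
    by simp
qed

section \<open>Determinants and minors of the strip\<close>

text \<open>
  With \<open>T\<close> the step matrix of the strip, \<open>Q w\<close> is the determinant of \<open>I - T\<close>, and \<open>P w\<close> its minor
  without row and column 0. The next two polynomials are, up to sign, the minors without row 0
  and column 1, and without row and column 1; they are 0 for \<open>w = 0\<close>.
\<close>

fun minor01 :: "nat \<Rightarrow> int poly" where
  "minor01 0 = 0"
| "minor01 (Suc w) = P w + [:0, 1:] * minor01 w"

fun minor11 :: "nat \<Rightarrow> int poly" where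
  "minor11 0 = 0"
| "minor11 (Suc 0) = 1"
| "minor11 (Suc (Suc w)) = P (Suc w) - [:0, 1:]^2 * P w"

lemma P_Suc: "P (Suc w) = Q w"
  by (cases w rule: Q.cases) simp_all

text \<open>This is the Laplace expansion along row 0, derived here from the defining recurrence of
  \<open>Q\<close>.\<close>

lemma Q_Suc:
  "Q (Suc w) = Q w - [:0, 1:] * P w - 2 * [:0, 1:]^2 * minor01 w - [:0, 1:]^2 * minor11 w"
proof (induction w)
  case 0
  show ?case by (simp add: one_pCons)
next
  case (Suc v)
  define z :: "int poly" where "z = [:0, 1:]"
  have coeffs: "[:1, 1:] = 1 + z" "[:0, 2:] = 2 * z" "[:0, 0, 2:] = 2 * z^2"
    "[:0, 0, 0, 1, 1:] = z^3 + z^4" "[:0, 0, 0, 0, 0, 1:] = z^5"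
    by (simp_all add: z_def numeral_poly power_numeral_reduce one_pCons)
  \<comment> \<open>That recurrence starts at index 5, so it covers \<open>Q (Suc (Suc v))\<close>
    only from \<open>v = 3\<close> on.\<close>
  consider "v = 0" | "v = Suc 0" | "v = Suc (Suc 0)" | k where "v = Suc (Suc (Suc k))"
    by (metis not0_implies_Suc)
  then show ?case
  proof cases
    case 4
    have IH: "Q (Suc (Suc (Suc (Suc k)))) = Q (Suc (Suc (Suc k))) - z * Q (Suc (Suc k))
      - 2 * z^2 * minor01 v - z^2 * (Q (Suc k) - z^2 * Q k)"
      using Suc.IH unfolding 4 by (simp only: z_def P_Suc minor11.simps)
    have "Q (Suc (Suc v)) = (1 + z) * Q (Suc (Suc (Suc (Suc k)))) - 2 * z * Q (Suc (Suc (Suc k)))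
      - 2 * z^2 * Q (Suc (Suc k)) + (z^3 + z^4) * Q (Suc k) - z^5 * Q k"
      unfolding 4 by (simp only: Q.simps(6) flip: coeffs)
    also have "\<dots> = Q (Suc v) - z * Q v
        - 2 * z^2 * (Q (Suc (Suc k)) + z * minor01 v) - z^2 * (Q (Suc (Suc k)) - z^2 * Q (Suc k))"
      \<comment> \<open>Adding \<open>z\<close> times the induction hypothesis cancels
        \<open>minor01 v\<close>, which the recurrence of \<open>Q\<close> does not contain.\<close>
      using arg_cong[OF IH, of "\<lambda>t. z * t"] unfolding 4
      by (simp add: algebra_simps numeral_eq_Suc del: Q.simps minor01.simps)
    finally show ?thesis
      unfolding z_def 4 by (simp only: P_Suc minor01.simps minor11.simps)
  qed (simp_all add: numeral_poly one_pCons power2_eq_square)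
qed

text \<open>
  Dodgson condensation for the first two rows and columns. After substituting the recurrences,
  the instance \<open>Suc w\<close> is \<open>z\<^sup>2\<close> times the instance \<open>w\<close>.
\<close>

lemma minor_identity:
  "minor11 (Suc w) * Q w = P w * Q (Suc w) + [:0, 1:] * (minor01 (Suc w))^2"
proof (induction w)
  case 0
  show ?case by (simp add: one_pCons power2_eq_square)
next
  case (Suc w)
  define z :: "int poly" where "z = [:0, 1:]"
  have q: "Q (Suc (Suc w)) = Q (Suc w) - z * Q w - 2 * z^2 * minor01 (Suc w) - z^2 * minor11 (Suc w)"
    using Q_Suc[of "Suc w"] by (simp only: P_Suc z_def)
  have n: "minor01 (Suc (Suc w)) = Q w + z * minor01 (Suc w)"
    by (simp only: minor01.simps P_Suc z_def)
  have m: "minor11 (Suc (Suc w)) = Q w - z^2 * P w"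
    by (simp only: minor11.simps P_Suc z_def)
  show ?case
    using arg_cong[OF Suc.IH, of "\<lambda>t. z^2 * t"]
    unfolding z_def[symmetric] q n m P_Suc
    by (simp add: algebra_simps power2_eq_square del: Q.simps minor01.simps minor11.simps)
qed

section \<open>From integer polynomials to rational power series\<close>

abbreviation series :: "int poly \<Rightarrow> rat fps" where
  "series p \<equiv> fps_of_poly (map_poly of_int p)"

lemma series_add: "series (p + q) = series p + series q"
  by (rule fps_ext) (simp add: coeff_map_poly)

lemma series_diff: "series (p - q) = series p - series q"
  by (rule fps_ext) (simp add: coeff_map_poly)

lemma series_mult: "series (p * q) = series p * series q"
  by (rule fps_ext) (simp add: coeff_map_poly coeff_mult fps_mult_nth atLeast0AtMost)

lemma series_2: "series 2 = 2"
  using series_add[of 1 1] by simp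

lemma series_X: "series [:0, 1:] = fps_X"
  by (simp add: map_poly_pCons)

theorem theorem3:
  fixes w :: nat
  shows "F w = fps_of_poly (map_poly of_int (P w)) / fps_of_poly (map_poly of_int (Q w))"
proof -
  note hom = series_add series_diff series_mult series_2 series_X power2_eq_square
  have nth0: "series (Q v) $ 0 = 1" for v
    by (simp add: coeff_map_poly coeff_Q_0)
  have "F w = height_gf w 0"
    by (simp add: F_def height_gf_def a_def strip_walks_eq)
  \<comment> \<open>The walk system has right-hand side \<open>p = 1\<close>, \<open>q = 0\<close>:
    only height 0 admits the empty walk.\<close>
  moreover have "series (Q w) * height_gf w 0 = series (P w) * 1 + fps_X * series (minor01 w) * 0 \<and>
      series (Q w) * height_gf w 1 = series (minor01 w) * 1 + series (minor11 w) * 0"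
  proof (rule strip_solution_values[where n = "\<lambda>v. series (minor01 v)"
        and m = "\<lambda>v. series (minor11 v)" and E = "\<lambda>v. series (P v)"])
    show "series (Q (Suc v)) = series (Q v) - fps_X * series (P v)
        - 2 * fps_X^2 * series (minor01 v) - fps_X^2 * series (minor11 v)" for v
      by (simp only: Q_Suc hom)
    show "series (minor11 (Suc v)) * series (Q v)
        = series (P v) * series (Q (Suc v)) + fps_X * (series (minor01 (Suc v)))^2" for v
      using arg_cong[OF minor_identity[of v], of series] by (simp only: hom)
    show "series (minor01 (Suc v)) = series (P v) + fps_X * series (minor01 v)" for v
      by (simp only: minor01.simps hom)
    show "series (Q v) \<noteq> 0" for v
      using nth0[of v] by force
  qed (simp_all add: P_Suc strip_solution_height_gf)
  ultimately have "series (Q w) * F w = series (P w)"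
    by simp
  moreover have "series (Q w) \<noteq> 0"
    using nth0[of w] by force
  ultimately show ?thesis
    by (metis nonzero_mult_div_cancel_left)
qed

end
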